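(* Up to equivalence there is a unique cell system on $\mathcal{E}^{(8)\ast}$, given by $$W_{123}=W_{234}=\sqrt{[2][3]},\qquad W_{223}=W_{233}=\frac{[3]}{\sqrt{[2]}},\qquad W_{222}=\frac{\sqrt{[3]^3}}{\sqrt{[2]}},\qquad W_{333}=-\frac{\sqrt{[3]^3}}{\sqrt{[2]}}.$$
   Context: Let $q=e^{\pi i/8}$ and $[m]=(q^m-q^{-m})/(q-q^{-1})$. The graph $\mathcal{E}^{(8)\ast}$ has vertices $1,2,3,4$ and exactly the following edges (one each): $1\to 2$, $2\to 2$, $2\to 3$, $2\to 4$, $3\to 1$, $3\to 2$, $3\to 3$, $4\to 3$. Its Perron-Frobenius eigenvector (eigenvalue $[3]$) is $\phi_1=\phi_4=1$, $\phi_2=\phi_3=[3]$. $W_{abc}$ denotes the value of $W$ on the unique triangle (closed path of length 3, up to cyclic rotation) with vertices $a,b,c$: $W_{123}$ is for $1\to2\to3\to1$, $W_{234}$ for $2\to4\to3\to2$, $W_{223}$ for $2\to2\to3\to2$, $W_{233}$ for $2\to3\to3\to2$, $W_{222}$ and $W_{333}$ for the loops traversed three times. Cell systems: let $\mathcal{G}$ be a directed graph (loops and multiple edges allowed), with source and range maps $s,r$, Perron-Frobenius eigenvalue $[3]$ and positive Perron-Frobenius eigenvector $(\phi_i)$. A triangle $\triangle_{ijk}^{(\alpha\beta\gamma)}$ is a closed path $i\xrightarrow{\alpha}j\xrightarrow{\beta}k\xrightarrow{\gamma}i$, considered up to cyclic rotation. A cell system $W$ assigns to each triangle a complex number $W(\triangle_{ijk}^{(\alpha\beta\gamma)})$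 such that: (I) for all edges $\alpha,\alpha'$ from $i$ to $j$, $\sum_{k,\beta,\gamma}W(\triangle_{ijk}^{(\alpha\beta\gamma)})\overline{W(\triangle_{ijk}^{(\alpha'\beta\gamma)})}=\delta_{\alpha,\alpha'}[2]\phi_i\phi_j$, the sum being over vertices $k$ and edges $\beta:j\to k$, $\gamma:k\to i$; (II) for all edges $\alpha_1,\dots,\alpha_4$ with $s(\alpha_1)=s(\alpha_4)=i_1$, $r(\alpha_1)=r(\alpha_2)=i_2$, $s(\alpha_2)=s(\alpha_3)=i_3$, $r(\alpha_3)=r(\alpha_4)=i_4$, $$\sum\phi_k^{-1}W(\triangle_{i_1i_2k}^{(\alpha_1\beta_1\beta_2)})\overline{W(\triangle_{i_3i_2k}^{(\alpha_2\beta_1\beta_3)})}W(\triangle_{i_3i_4k}^{(\alpha_3\beta_4\beta_3)})\overline{W(\triangle_{i_1i_4k}^{(\alpha_4\beta_4\beta_2)})}=\delta_{\alpha_1,\alpha_4}\delta_{\alpha_2,\alpha_3}\phi_{i_1}\phi_{i_2}\phi_{i_3}+\delta_{\alpha_1,\alpha_2}\delta_{\alpha_3,\alpha_4}\phi_{i_1}\phi_{i_2}\phi_{i_4},$$ the sum being over vertices $k$ and edges $\beta_1:i_2\to k$, $\beta_2:k\to i_1$, $\beta_3:k\to i_3$, $\beta_4:i_4\to k$. Two cell systems $W_1,W_2$ on $\mathcal{G}$ are equivalent if for each pair of adjacent vertices $i,j$ there is a unitary matrix $(u(\sigma,\sigma'))$ indexed by the edges from $i$ to $j$ such that for every triangle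 $W_1(\triangle_{ijk}^{(\sigma\rho\gamma)})=\sum_{\sigma',\rho',\gamma'}u(\sigma,\sigma')u(\rho,\rho')u(\gamma,\gamma')W_2(\triangle_{ijk}^{(\sigma'\rho'\gamma')})$, summing over edges $\sigma':i\to j$, $\rho':j\to k$, $\gamma':k\to i$. *)

theory Defs
  imports "HOL-Analysis.Analysis" "Graph_Theory.Digraph"
begin

definition q :: complex where
  "q = exp (complex_of_real pi * \<i> / 8)"

text \<open>The quotient below is a real number (see \<open>of_real_qint\<close>); taking the real part only
  turns it into an element of type \<^typ>\<open>real\<close>.\<close>

definition qint :: "int \<Rightarrow> real" where
  "qint m = Re ((q powi m - q powi (-m)) / (q - inverse q))"

lemma of_real_qint:
  "complex_of_real (qint m) = (q powi m - q powi (-m)) / (q - inverse q)"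
proof -
  have cq: "cnj q = inverse q"
    by (simp add: q_def exp_cnj flip: exp_minus)
  have cp: "cnj (q powi n) = q powi (-n)" for n
    by (simp add: cq power_int_inverse power_int_minus)
  have "cnj (q powi m - q powi (-m)) = - (q powi m - q powi (-m))"
    using cp[of m] cp[of "-m"] by (simp only: complex_cnj_diff minus_minus minus_diff_eq)
  moreover have "cnj (q - inverse q) = - (q - inverse q)"
    by (simp only: complex_cnj_diff complex_cnj_inverse cq inverse_inverse_eq minus_diff_eq)
  ultimately have "cnj ((q powi m - q powi (-m)) / (q - inverse q))
      = (q powi m - q powi (-m)) / (q - inverse q)"
    by (simp only: complex_cnj_divide minus_divide_divide)
  then show ?thesis
    unfolding qint_def by (metis Reals_cnj_iff of_real_Re)
qed

definition arcs_from_to :: "('v, 'e) pre_digraph \<Rightarrow> 'v \<Rightarrow> 'v \<Rightarrow> 'e set" where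
  "arcs_from_to G i j = {e \<in> arcs G. tail G e = i \<and> head G e = j}"

definition adjacency :: "('v, 'e) pre_digraph \<Rightarrow> 'v \<Rightarrow> 'v \<Rightarrow> nat" where
  "adjacency G i j = card (arcs_from_to G i j)"

text \<open>\<open>r\<close> is the spectral radius of the adjacency matrix, and \<open>\<phi>\<close> is a positive
  eigenvector for it.\<close>

definition perron_frobenius :: "('v, 'e) pre_digraph \<Rightarrow> real \<Rightarrow> ('v \<Rightarrow> real) \<Rightarrow> bool" where
  "perron_frobenius G r \<phi> \<longleftrightarrow>
     (\<forall>i\<in>verts G. \<phi> i > 0) \<and>
     (\<forall>i\<in>verts G. (\<Sum>j\<in>verts G. real (adjacency G i j) * \<phi> j) = r * \<phi> i) \<and>
     (\<forall>(\<mu>::complex) (x::'v \<Rightarrow> complex).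
        (\<exists>i\<in>verts G. x i \<noteq> 0) \<and>
        (\<forall>i\<in>verts G. (\<Sum>j\<in>verts G. of_nat (adjacency G i j) * x j) = \<mu> * x i)
        \<longrightarrow> cmod \<mu> \<le> r)"

definition is_triangle :: "('v, 'e) pre_digraph \<Rightarrow> 'e \<Rightarrow> 'e \<Rightarrow> 'e \<Rightarrow> bool" where
  "is_triangle G \<alpha> \<beta> \<gamma> \<longleftrightarrow>
     \<alpha> \<in> arcs G \<and> \<beta> \<in> arcs G \<and> \<gamma> \<in> arcs G \<and>
     head G \<alpha> = tail G \<beta> \<and> head G \<beta> = tail G \<gamma> \<and> head G \<gamma> = tail G \<alpha>"

text \<open>A function on triangles up to cyclic rotation is encoded as a function of three edges
  which is rotation invariant on triangles; its values off triangles are irrelevant.\<close>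

definition rotation_invariant ::
    "('v, 'e) pre_digraph \<Rightarrow> ('e \<Rightarrow> 'e \<Rightarrow> 'e \<Rightarrow> complex) \<Rightarrow> bool" where
  "rotation_invariant G W \<longleftrightarrow>
     (\<forall>\<alpha> \<beta> \<gamma>. is_triangle G \<alpha> \<beta> \<gamma> \<longrightarrow> W \<alpha> \<beta> \<gamma> = W \<beta> \<gamma> \<alpha>)"

definition type_I ::
    "('v, 'e) pre_digraph \<Rightarrow> ('v \<Rightarrow> real) \<Rightarrow> ('e \<Rightarrow> 'e \<Rightarrow> 'e \<Rightarrow> complex) \<Rightarrow> bool" where
  "type_I G \<phi> W \<longleftrightarrow>
     (\<forall>i\<in>verts G. \<forall>j\<in>verts G. \<forall>\<alpha>\<in>arcs_from_to G i j. \<forall>\<alpha>'\<in>arcs_from_to G i j.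
        (\<Sum>k\<in>verts G. \<Sum>\<beta>\<in>arcs_from_to G j k. \<Sum>\<gamma>\<in>arcs_from_to G k i.
           W \<alpha> \<beta> \<gamma> * cnj (W \<alpha>' \<beta> \<gamma>))
        = of_bool (\<alpha> = \<alpha>') * complex_of_real (qint 2 * \<phi> i * \<phi> j))"

definition type_II ::
    "('v, 'e) pre_digraph \<Rightarrow> ('v \<Rightarrow> real) \<Rightarrow> ('e \<Rightarrow> 'e \<Rightarrow> 'e \<Rightarrow> complex) \<Rightarrow> bool" where
  "type_II G \<phi> W \<longleftrightarrow>
     (\<forall>i\<^sub>1\<in>verts G. \<forall>i\<^sub>2\<in>verts G. \<forall>i\<^sub>3\<in>verts G. \<forall>i\<^sub>4\<in>verts G.
      \<forall>\<alpha>\<^sub>1\<in>arcs_from_to G i\<^sub>1 i\<^sub>2. \<forall>\<alpha>\<^sub>2\<in>arcs_from_to G i\<^sub>3 i\<^sub>2.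
      \<forall>\<alpha>\<^sub>3\<in>arcs_from_to G i\<^sub>3 i\<^sub>4. \<forall>\<alpha>\<^sub>4\<in>arcs_from_to G i\<^sub>1 i\<^sub>4.
        (\<Sum>k\<in>verts G.
         \<Sum>\<beta>\<^sub>1\<in>arcs_from_to G i\<^sub>2 k. \<Sum>\<beta>\<^sub>2\<in>arcs_from_to G k i\<^sub>1.
         \<Sum>\<beta>\<^sub>3\<in>arcs_from_to G k i\<^sub>3. \<Sum>\<beta>\<^sub>4\<in>arcs_from_to G i\<^sub>4 k.
           complex_of_real (inverse (\<phi> k)) *
           W \<alpha>\<^sub>1 \<beta>\<^sub>1 \<beta>\<^sub>2 * cnj (W \<alpha>\<^sub>2 \<beta>\<^sub>1 \<beta>\<^sub>3) * W \<alpha>\<^sub>3 \<beta>\<^sub>4 \<beta>\<^sub>3 * cnj (W \<alpha>\<^sub>4 \<beta>\<^sub>4 \<beta>\<^sub>2))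
        = of_bool (\<alpha>\<^sub>1 = \<alpha>\<^sub>4) * of_bool (\<alpha>\<^sub>2 = \<alpha>\<^sub>3) * complex_of_real (\<phi> i\<^sub>1 * \<phi> i\<^sub>2 * \<phi> i\<^sub>3)
        + of_bool (\<alpha>\<^sub>1 = \<alpha>\<^sub>2) * of_bool (\<alpha>\<^sub>3 = \<alpha>\<^sub>4) * complex_of_real (\<phi> i\<^sub>1 * \<phi> i\<^sub>2 * \<phi> i\<^sub>4))"

definition cell_system ::
    "('v, 'e) pre_digraph \<Rightarrow> ('v \<Rightarrow> real) \<Rightarrow> ('e \<Rightarrow> 'e \<Rightarrow> 'e \<Rightarrow> complex) \<Rightarrow> bool" where
  "cell_system G \<phi> W \<longleftrightarrow>
     fin_digraph G \<and> perron_frobenius G (qint 3) \<phi> \<and>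
     rotation_invariant G W \<and> type_I G \<phi> W \<and> type_II G \<phi> W"

definition unitary_on :: "'e set \<Rightarrow> ('e \<Rightarrow> 'e \<Rightarrow> complex) \<Rightarrow> bool" where
  "unitary_on E u \<longleftrightarrow>
     (\<forall>\<sigma>\<in>E. \<forall>\<tau>\<in>E. (\<Sum>\<rho>\<in>E. u \<sigma> \<rho> * cnj (u \<tau> \<rho>)) = of_bool (\<sigma> = \<tau>)) \<and>
     (\<forall>\<sigma>\<in>E. \<forall>\<tau>\<in>E. (\<Sum>\<rho>\<in>E. cnj (u \<rho> \<sigma>) * u \<rho> \<tau>) = of_bool (\<sigma> = \<tau>))"

text \<open>Since an edge determines its end points, the unitary matrices attached to the pairs of
  adjacent vertices are the diagonal blocks of a single function of two edges.\<close>

definition cell_equiv ::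
    "('v, 'e) pre_digraph \<Rightarrow> ('e \<Rightarrow> 'e \<Rightarrow> 'e \<Rightarrow> complex) \<Rightarrow>
     ('e \<Rightarrow> 'e \<Rightarrow> 'e \<Rightarrow> complex) \<Rightarrow> bool" where
  "cell_equiv G W\<^sub>1 W\<^sub>2 \<longleftrightarrow>
     (\<exists>u :: 'e \<Rightarrow> 'e \<Rightarrow> complex.
        (\<forall>i\<in>verts G. \<forall>j\<in>verts G. unitary_on (arcs_from_to G i j) u) \<and>
        (\<forall>i\<in>verts G. \<forall>j\<in>verts G. \<forall>k\<in>verts G.
         \<forall>\<sigma>\<in>arcs_from_to G i j. \<forall>\<rho>\<in>arcs_from_to G j k. \<forall>\<gamma>\<in>arcs_from_to G k i.
           W\<^sub>1 \<sigma> \<rho> \<gamma> =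
           (\<Sum>\<sigma>'\<in>arcs_from_to G i j. \<Sum>\<rho>'\<in>arcs_from_to G j k. \<Sum>\<gamma>'\<in>arcs_from_to G k i.
              u \<sigma> \<sigma>' * u \<rho> \<rho>' * u \<gamma> \<gamma>' * W\<^sub>2 \<sigma>' \<rho>' \<gamma>')))"

definition E8star :: "(nat, nat \<times> nat) pre_digraph" where
  "E8star = \<lparr> verts = {1, 2, 3, 4},
     arcs = {(1, 2), (2, 2), (2, 3), (2, 4), (3, 1), (3, 2), (3, 3), (4, 3)},
     tail = fst, head = snd \<rparr>"

definition phi_E8star :: "nat \<Rightarrow> real" where
  "phi_E8star i = (if i = 2 \<or> i = 3 then qint 3 else 1)"

text \<open>The value on the triangle \<open>a \<rightarrow> b \<rightarrow> c \<rightarrow> a\<close> of a graph without multiple edges, whose edges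
  are the pairs of their end points.\<close>

definition on_vertices ::
    "(nat \<times> nat \<Rightarrow> nat \<times> nat \<Rightarrow> nat \<times> nat \<Rightarrow> complex) \<Rightarrow> nat \<Rightarrow> nat \<Rightarrow> nat \<Rightarrow> complex" where
  "on_vertices W a b c = W (a, b) (b, c) (c, a)"

end

theory Submission
  imports Defs
begin

text \<open>
  Write \<open>a = [3]\<close> and \<open>b = [2]\<close>. Everything rests on the two relations \<open>b\<^sup>2 = a + 1\<close> and
  \<open>a\<^sup>2 = 2 a + 1\<close>; the second one holds because \<open>q\<^sup>4 = \<i>\<close>. The graph has no multiple edges, so each
  inner sum over edges has at most one term, a cell system consists of the six numbers
  \<open>W\<^sub>1\<^sub>2\<^sub>3\<close>, \<open>W\<^sub>2\<^sub>4\<^sub>3\<close>, \<open>W\<^sub>2\<^sub>2\<^sub>3\<close>, \<open>W\<^sub>2\<^sub>3\<^sub>3\<close>, \<open>W\<^sub>2\<^sub>2\<^sub>2\<close>, \<open>W\<^sub>3\<^sub>3\<^sub>3\<close>,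
  and an equivalence is a choice of one phase for each edge.

  Existence. All equations become polynomial identities in \<open>a\<close>, \<open>b\<close> and the three absolute
  values, which follow from the relations above together with \<open>1 / a = a - 2\<close>. Only one
  equation sees the signs, and it is the reason for the minus sign of \<open>W\<^sub>3\<^sub>3\<^sub>3\<close>.

  Uniqueness of the absolute values (\<open>cell_system_E8star_relations\<close>). Type I at the edges
  \<open>1 \<rightarrow> 2\<close> and \<open>2 \<rightarrow> 4\<close> gives \<open>\<bar>W\<^sub>1\<^sub>2\<^sub>3\<bar>\<close> and \<open>\<bar>W\<^sub>2\<^sub>4\<^sub>3\<bar>\<close> at once. At each of the two loops,
  types I and II together prescribe \<open>x + y\<close> and \<open>x\<^sup>2 + y\<^sup>2\<close>, where \<open>x\<close> and \<open>y\<close> are the squared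
  absolute values at the threefold loop (\<open>W\<^sub>2\<^sub>2\<^sub>2\<close> or \<open>W\<^sub>3\<^sub>3\<^sub>3\<close>) and at the triangle \<open>W\<^sub>2\<^sub>2\<^sub>3\<close> or \<open>W\<^sub>2\<^sub>3\<^sub>3\<close>, with the same
  right-hand sides. So \<open>y\<close> is one of two roots. If the loops chose different roots, their sum
  would be \<open>b a\<^sup>2\<close>, whereas type I at \<open>2 \<rightarrow> 3\<close> makes it \<open>b (a + 1)\<close>; hence the roots agree and
  each is half of \<open>b (a + 1)\<close>.

  Uniqueness of the phases (\<open>cell_system_E8star_unique\<close>). The six phases can be changed by
  eight edge phases. The triangles \<open>1 2 3\<close> and \<open>2 4 3\<close> contain edges of their own; on the other
  four triangles the edge phases act only through those of \<open>2 \<rightarrow> 2\<close>, \<open>3 \<rightarrow> 3\<close> and the product for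
  \<open>2 \<rightarrow> 3 \<rightarrow> 2\<close>, and they preserve the phase of \<open>W\<^sub>2\<^sub>2\<^sub>2 W\<^sub>2\<^sub>3\<^sub>3\<^sup>3 / (W\<^sub>3\<^sub>3\<^sub>3 W\<^sub>2\<^sub>2\<^sub>3\<^sup>3)\<close>. Type II with both
  sources and both targets distinct says precisely that this invariant is \<open>-1\<close>.
\<close>

section \<open>The quantum integers at the sixteenth root of unity\<close>

lemma qint_eq_sin: "qint m = sin (of_int m * pi / 8) / sin (pi / 8)"
proof -
  have q: "q = cis (pi / 8)"
    by (simp add: q_def cis_conv_exp mult.commute)
  have pw: "q powi n = cis (of_int n * pi / 8)" for n
    by (simp add: q cis_power_int)
  have "q powi m - q powi (- m) = of_real (2 * sin (of_int m * pi / 8)) * \<i>"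
    by (simp add: pw complex_eq_iff)
  moreover have "q - inverse q = of_real (2 * sin (pi / 8)) * \<i>"
    by (simp add: q complex_eq_iff cis_inverse)
  ultimately have "(q powi m - q powi (- m)) / (q - inverse q)
      = of_real (sin (of_int m * pi / 8) / sin (pi / 8))"
    by simp
  then show ?thesis
    by (simp only: qint_def Re_complex_of_real)
qed

lemma qint_pos: "0 < m \<Longrightarrow> m < 8 \<Longrightarrow> 0 < qint m"
  unfolding qint_eq_sin by (intro divide_pos_pos sin_gt_zero) auto

text \<open>With \<open>x = \<pi> / 8\<close> one has \<open>[2] = 2 cos x\<close> and \<open>[3] = 1 + 2 cos 2x\<close>, so these are the double
  angle formula and \<open>cos 2x = 1 / \<surd>2\<close>.\<close>

lemma qint_2_squared: "(qint 2)\<^sup>2 = qint 3 + 1"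
  and qint_3_squared: "(qint 3)\<^sup>2 = 2 * qint 3 + 1"
proof -
  define x :: real where "x = pi / 8"
  have s: "sin x > 0"
    unfolding x_def by (rule sin_gt_zero) auto
  have two: "qint 2 = 2 * cos x"
    using s by (simp add: qint_eq_sin x_def sin_double[of "pi / 8", simplified])
  have "sin (3 * x) = sin (2 * x + x)"
    by simp
  also have "\<dots> = (2 * cos (2 * x) + 1) * sin x"
    by (simp only: sin_add sin_double cos_double_cos) (simp add: algebra_simps power2_eq_square)
  finally have three: "qint 3 = 2 * cos (2 * x) + 1"
    using s by (simp add: qint_eq_sin x_def)
  show "(qint 2)\<^sup>2 = qint 3 + 1"
    by (simp add: two three cos_double_cos power_mult_distrib)
  have "(cos (2 * x))\<^sup>2 = 1 / 2"
    by (simp add: x_def cos_45 power_divide)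
  then show "(qint 3)\<^sup>2 = 2 * qint 3 + 1"
    by (simp add: three power2_sum power_mult_distrib)
qed

lemma inverse_qint_3: "inverse (qint 3) = qint 3 - 2"
proof -
  have "qint 3 * (qint 3 - 2) = 1"
    using qint_3_squared by (simp add: algebra_simps power2_eq_square)
  then show ?thesis
    by (rule inverse_unique)
qed

section \<open>The cell equations on a graph without multiple edges\<close>

lemma arcs_from_to_E8star:
  "arcs_from_to E8star i j = (if (i, j) \<in> arcs E8star then {(i, j)} else {})"
proof -
  have "tail E8star = fst" "head E8star = snd"
    by (simp_all add: E8star_def)
  then show ?thesis
    by (auto simp: arcs_from_to_def)
qed

lemma sum_arcs_from_to_E8star:
  "(\<Sum>e\<in>arcs_from_to E8star i j. f e) = (if (i, j) \<in> arcs E8star then f (i, j) else 0)"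
  by (simp add: arcs_from_to_E8star)

lemma ball_arcs_from_to_E8star:
  "(\<forall>e\<in>arcs_from_to E8star i j. P e) \<longleftrightarrow> ((i, j) \<in> arcs E8star \<longrightarrow> P (i, j))"
  by (simp add: arcs_from_to_E8star)

lemma adjacency_E8star: "adjacency E8star i j = of_bool ((i, j) \<in> arcs E8star)"
  by (simp add: adjacency_def arcs_from_to_E8star)

lemma mem_arcs_E8star:
  "(i, j) \<in> arcs E8star \<longleftrightarrow>
     i = 1 \<and> j = 2 \<or> i = 2 \<and> j \<in> {2, 3, 4} \<or> i = 3 \<and> j \<in> {1, 2, 3} \<or> i = 4 \<and> j = 3"
  by (auto simp: E8star_def)

lemma verts_E8star: "verts E8star = {1, 2, 3, 4}"
  by (simp add: E8star_def)

lemma sum_verts_E8star: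
  "(\<Sum>k\<in>verts E8star. f k) = f 1 + f 2 + f 3 + (f 4 :: 'a :: comm_monoid_add)"
  by (simp add: verts_E8star add.assoc)

lemma if_zero_eq_of_bool: "(if P then x else 0) = of_bool P * (x :: complex)"
  by simp

lemma type_I_E8star_iff:
  "type_I E8star \<phi> W \<longleftrightarrow>
     (\<forall>i\<in>verts E8star. \<forall>j\<in>verts E8star. (i, j) \<in> arcs E8star \<longrightarrow>
        (\<Sum>k\<in>verts E8star. of_bool ((j, k) \<in> arcs E8star \<and> (k, i) \<in> arcs E8star) *
           (on_vertices W i j k * cnj (on_vertices W i j k)))
        = complex_of_real (qint 2 * \<phi> i * \<phi> j))"
  unfolding type_I_def ball_arcs_from_to_E8star sum_arcs_from_to_E8star on_vertices_def
  by (simp add: if_zero_eq_of_bool of_bool_conj mult.assoc)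

lemma type_II_E8star_iff:
  "type_II E8star \<phi> W \<longleftrightarrow>
     (\<forall>i\<^sub>1\<in>verts E8star. \<forall>i\<^sub>2\<in>verts E8star. \<forall>i\<^sub>3\<in>verts E8star. \<forall>i\<^sub>4\<in>verts E8star.
      (i\<^sub>1, i\<^sub>2) \<in> arcs E8star \<longrightarrow> (i\<^sub>3, i\<^sub>2) \<in> arcs E8star \<longrightarrow>
      (i\<^sub>3, i\<^sub>4) \<in> arcs E8star \<longrightarrow> (i\<^sub>1, i\<^sub>4) \<in> arcs E8star \<longrightarrow>
        (\<Sum>k\<in>verts E8star. of_bool ((i\<^sub>2, k) \<in> arcs E8star \<and> (k, i\<^sub>1) \<in> arcs E8star \<and>
              (k, i\<^sub>3) \<in> arcs E8star \<and> (i\<^sub>4, k) \<in> arcs E8star) *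
           (complex_of_real (inverse (\<phi> k)) *
              on_vertices W i\<^sub>1 i\<^sub>2 k * cnj (on_vertices W i\<^sub>3 i\<^sub>2 k) *
              on_vertices W i\<^sub>3 i\<^sub>4 k * cnj (on_vertices W i\<^sub>1 i\<^sub>4 k)))
        = complex_of_real (of_bool (i\<^sub>2 = i\<^sub>4) * (\<phi> i\<^sub>1 * \<phi> i\<^sub>2 * \<phi> i\<^sub>3)
            + of_bool (i\<^sub>1 = i\<^sub>3) * (\<phi> i\<^sub>1 * \<phi> i\<^sub>2 * \<phi> i\<^sub>4)))"
  unfolding type_II_def ball_arcs_from_to_E8star sum_arcs_from_to_E8star on_vertices_def
  by (simp add: if_zero_eq_of_bool of_bool_conj mult.assoc)

section \<open>The Perron-Frobenius eigenvector\<close>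

lemma fin_digraph_E8star: "fin_digraph E8star"
  by unfold_locales (auto simp: E8star_def)

lemma phi_E8star_pos: "0 < phi_E8star i"
  using qint_pos[of 3] by (simp add: phi_E8star_def)

text \<open>The norm \<open>x \<mapsto> max\<^sub>i \<bar>x\<^sub>i\<bar> / \<phi>\<^sub>i\<close> turns the nonnegative adjacency matrix into an operator
  of norm \<open>r\<close>, so no eigenvalue exceeds \<open>r\<close>; concretely, an eigenvector is compared with \<open>\<phi>\<close> at a
  vertex where the maximum is attained.\<close>

lemma perron_frobenius_if_pos_eigenvector:
  fixes G :: "('v, 'e) pre_digraph"
  assumes fin: "finite (verts G)"
    and pos: "\<And>i. i \<in> verts G \<Longrightarrow> 0 < \<phi> i"
    and eig: "\<And>i. i \<in> verts G \<Longrightarrow> (\<Sum>j\<in>verts G. real (adjacency G i j) * \<phi> j) = r * \<phi> i"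
  shows "perron_frobenius G r \<phi>"
  unfolding perron_frobenius_def
proof (intro conjI ballI allI impI pos eig)
  fix \<mu> :: complex and x :: "'v \<Rightarrow> complex"
  assume "(\<exists>i\<in>verts G. x i \<noteq> 0) \<and>
    (\<forall>i\<in>verts G. (\<Sum>j\<in>verts G. of_nat (adjacency G i j) * x j) = \<mu> * x i)"
  then obtain i0 where i0: "i0 \<in> verts G" "x i0 \<noteq> 0"
    and mu: "\<And>i. i \<in> verts G \<Longrightarrow> (\<Sum>j\<in>verts G. of_nat (adjacency G i j) * x j) = \<mu> * x i"
    by blast
  define c where "c = Max ((\<lambda>i. cmod (x i) / \<phi> i) ` verts G)"
  have c_ge: "cmod (x i) / \<phi> i \<le> c" if "i \<in> verts G" for i
    unfolding c_def using fin that by (intro Max_ge) auto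
  have "c \<in> (\<lambda>i. cmod (x i) / \<phi> i) ` verts G"
    unfolding c_def using fin i0 by (intro Max_in) auto
  then obtain m where m: "m \<in> verts G" "c = cmod (x m) / \<phi> m"
    by blast
  have bound: "cmod (x i) \<le> c * \<phi> i" if "i \<in> verts G" for i
    using c_ge[OF that] pos[OF that] by (simp add: field_simps)
  have "0 < cmod (x i0) / \<phi> i0"
    using i0 pos by simp
  with c_ge[OF i0(1)] have "0 < c"
    by linarith
  then have xm: "0 < cmod (x m)" and cm: "c * \<phi> m = cmod (x m)"
    using m pos[OF m(1)] by (auto simp: zero_less_divide_iff)
  have "cmod \<mu> * cmod (x m) = cmod (\<Sum>j\<in>verts G. of_nat (adjacency G m j) * x j)"
    using mu[OF m(1)] by (simp add: norm_mult)
  also have "\<dots> \<le> (\<Sum>j\<in>verts G. real (adjacency G m j) * (c * \<phi> j))"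
    using bound by (intro sum_norm_le) (simp add: norm_mult mult_left_mono)
  also have "\<dots> = c * (\<Sum>j\<in>verts G. real (adjacency G m j) * \<phi> j)"
    by (simp add: sum_distrib_left mult_ac)
  also have "\<dots> = r * cmod (x m)"
    using eig[OF m(1)] cm by (simp add: mult_ac)
  finally show "cmod \<mu> \<le> r"
    using xm by simp
qed

lemma perron_frobenius_E8star: "perron_frobenius E8star (qint 3) phi_E8star"
proof (rule perron_frobenius_if_pos_eigenvector)
  fix i assume "i \<in> verts E8star"
  then have "i = 1 \<or> i = 2 \<or> i = 3 \<or> i = 4"
    by (simp add: verts_E8star)
  then show "(\<Sum>j\<in>verts E8star. real (adjacency E8star i j) * phi_E8star j)
      = qint 3 * phi_E8star i"
    using qint_3_squared
    by (elim disjE; simp add: sum_verts_E8star adjacency_E8star mem_arcs_E8star phi_E8star_def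
        power2_eq_square)
qed (auto simp: verts_E8star phi_E8star_pos)

section \<open>Existence\<close>

text \<open>A real weight that depends only on the set of vertices of the triangle. The vertices
  \<open>1\<close> and \<open>4\<close> occur only in the triangles \<open>1 2 3\<close> and \<open>2 4 3\<close>, which share the value \<open>p\<close>.\<close>

definition E8star_weight :: "real \<Rightarrow> real \<Rightarrow> real \<Rightarrow> nat \<Rightarrow> nat \<Rightarrow> nat \<Rightarrow> real" where
  "E8star_weight p r t i j k =
     (if 1 \<in> {i, j, k} \<or> 4 \<in> {i, j, k} then p
      else if i = j \<and> j = k then (if i = 2 then t else - t)
      else r)"

definition E8star_cell :: "real \<Rightarrow> real \<Rightarrow> real \<Rightarrow> nat \<times> nat \<Rightarrow> nat \<times> nat \<Rightarrow> nat \<times> nat \<Rightarrow> complex" where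
  "E8star_cell p r t e f g = complex_of_real (E8star_weight p r t (fst e) (fst f) (fst g))"

lemma on_vertices_E8star_cell:
  "on_vertices (E8star_cell p r t) i j k = complex_of_real (E8star_weight p r t i j k)"
  by (simp add: on_vertices_def E8star_cell_def)

lemma of_bool_eq_complex_of_real: "(of_bool P :: complex) = complex_of_real (of_bool P)"
  by simp

lemma rotation_invariant_E8star_cell: "rotation_invariant E8star (E8star_cell p r t)"
  by (auto simp: rotation_invariant_def E8star_cell_def E8star_weight_def)

text \<open>The relation for \<open>r\<close> amounts to \<open>2 [3]\<^sup>2 = ([3] + 1)\<^sup>2 = [2]\<^sup>4\<close>. In this form the
  relations are polynomial, with neither roots nor quotients of quantum integers.\<close>

lemma E8star_weight_relations:
  fixes p r t :: real
  defines "p \<equiv> sqrt (qint 2 * qint 3)"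
    and "r \<equiv> qint 3 / sqrt (qint 2)"
    and "t \<equiv> sqrt (qint 3 ^ 3) / sqrt (qint 2)"
  shows "p * p = qint 2 * qint 3"
    and "r * r = qint 2 * (qint 3 + 1) / 2"
    and "t * t = qint 3 * (r * r)"
proof -
  have a: "qint 3 > 0" and b: "qint 2 > 0"
    by (simp_all add: qint_pos)
  show "p * p = qint 2 * qint 3"
    using a b by (simp add: p_def)
  have rr: "r * r = (qint 3)\<^sup>2 / qint 2"
    using b by (simp add: r_def power2_eq_square)
  have "2 * (qint 3)\<^sup>2 = (qint 3 + 1) * (qint 3 + 1)"
    using qint_3_squared by (simp add: algebra_simps power2_eq_square)
  also have "\<dots> = qint 2 * (qint 3 + 1) * qint 2"
    unfolding qint_2_squared[symmetric] by (simp add: power2_eq_square)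
  finally show "r * r = qint 2 * (qint 3 + 1) / 2"
    unfolding rr using b by (simp add: field_simps)
  show "t * t = qint 3 * (r * r)"
    unfolding rr using a b by (simp add: t_def power2_eq_square power3_eq_cube)
qed

lemma type_I_E8star_cell:
  assumes "p * p = qint 2 * qint 3"
    and "r * r = qint 2 * (qint 3 + 1) / 2"
    and "t * t = qint 3 * (r * r)"
  shows "type_I E8star phi_E8star (E8star_cell p r t)"
proof -
  have "\<forall>i\<in>verts E8star. \<forall>j\<in>verts E8star. (i, j) \<in> arcs E8star \<longrightarrow>
     (\<Sum>k\<in>verts E8star. of_bool ((j, k) \<in> arcs E8star \<and> (k, i) \<in> arcs E8star) *
          (E8star_weight p r t i j k * E8star_weight p r t i j k))
      = qint 2 * phi_E8star i * phi_E8star j"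
    unfolding sum_verts_E8star
    by (simp add: verts_E8star mem_arcs_E8star phi_E8star_def E8star_weight_def)
      (intro conjI; use assms qint_2_squared qint_3_squared in algebra)
  then show ?thesis
    unfolding type_I_E8star_iff on_vertices_E8star_cell complex_cnj_complex_of_real
      of_bool_eq_complex_of_real of_real_mult[symmetric] of_real_sum[symmetric] of_real_eq_iff .
qed

text \<open>The equations with the edges \<open>2 \<rightarrow> 2\<close>, \<open>3 \<rightarrow> 2\<close>, \<open>3 \<rightarrow> 3\<close>, \<open>2 \<rightarrow> 3\<close> read \<open>t r\<^sup>3 / [3] - t r\<^sup>3 / [3] = 0\<close>
  and hold by the choice of signs. In all others every factor occurs in even degree.\<close>

lemma type_II_E8star_cell:
  assumes "p * p = qint 2 * qint 3"
    and "r * r = qint 2 * (qint 3 + 1) / 2"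
    and "t * t = qint 3 * (r * r)"
  shows "type_II E8star phi_E8star (E8star_cell p r t)"
proof -
  \<comment> \<open>Keeping the equation folded until the quadruples of edges are enumerated avoids expanding
    it for quadruples of vertices that are not joined by edges.\<close>
  define eqn where "eqn i\<^sub>1 i\<^sub>2 i\<^sub>3 i\<^sub>4 \<longleftrightarrow>
        (\<Sum>k\<in>verts E8star. of_bool ((i\<^sub>2, k) \<in> arcs E8star \<and> (k, i\<^sub>1) \<in> arcs E8star \<and>
              (k, i\<^sub>3) \<in> arcs E8star \<and> (i\<^sub>4, k) \<in> arcs E8star) *
           (inverse (phi_E8star k) *
              E8star_weight p r t i\<^sub>1 i\<^sub>2 k * E8star_weight p r t i\<^sub>3 i\<^sub>2 k *
              E8star_weight p r t i\<^sub>3 i\<^sub>4 k * E8star_weight p r t i\<^sub>1 i\<^sub>4 k))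
        = of_bool (i\<^sub>2 = i\<^sub>4) * (phi_E8star i\<^sub>1 * phi_E8star i\<^sub>2 * phi_E8star i\<^sub>3)
            + of_bool (i\<^sub>1 = i\<^sub>3) * (phi_E8star i\<^sub>1 * phi_E8star i\<^sub>2 * phi_E8star i\<^sub>4)"
    for i\<^sub>1 i\<^sub>2 i\<^sub>3 i\<^sub>4
  \<comment> \<open>Rewriting squares turns both sides of each equation into a linear polynomial in \<open>[3]\<close>.\<close>
  have a: "qint 3 * qint 3 = 2 * qint 3 + 1" and b: "qint 2 * qint 2 = qint 3 + 1"
    using qint_3_squared qint_2_squared by (simp_all add: power2_eq_square)
  have r: "r * r = qint 2 * (qint 3 + 1) * (1 / 2)"
    and t: "t * t = qint 3 * (qint 2 * (qint 3 + 1) * (1 / 2))"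
    using assms by simp_all
  note reduce = a b assms(1) r t
  have square: "x * x = y \<Longrightarrow> x * (x * z) = y * z" for x y z :: real
    by (simp add: mult.assoc[symmetric])
  have "\<forall>i\<^sub>1\<in>verts E8star. \<forall>i\<^sub>2\<in>verts E8star. \<forall>i\<^sub>3\<in>verts E8star. \<forall>i\<^sub>4\<in>verts E8star.
      (i\<^sub>1, i\<^sub>2) \<in> arcs E8star \<longrightarrow> (i\<^sub>3, i\<^sub>2) \<in> arcs E8star \<longrightarrow>
      (i\<^sub>3, i\<^sub>4) \<in> arcs E8star \<longrightarrow> (i\<^sub>1, i\<^sub>4) \<in> arcs E8star \<longrightarrow> eqn i\<^sub>1 i\<^sub>2 i\<^sub>3 i\<^sub>4"
    by (simp add: verts_E8star mem_arcs_E8star)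
      (simp add: eqn_def sum_verts_E8star mem_arcs_E8star phi_E8star_def E8star_weight_def
        inverse_qint_3,
       intro conjI; simp add: reduce reduce[THEN square] algebra_simps; simp add: field_simps)
  then show ?thesis
    unfolding type_II_E8star_iff on_vertices_E8star_cell complex_cnj_complex_of_real eqn_def
      of_bool_eq_complex_of_real of_real_mult[symmetric] of_real_sum[symmetric] of_real_eq_iff .
qed

section \<open>Uniqueness\<close>

lemma on_vertices_rotate:
  assumes "rotation_invariant E8star W"
    and "(i, j) \<in> arcs E8star" "(j, k) \<in> arcs E8star" "(k, i) \<in> arcs E8star"
  shows "on_vertices W j k i = on_vertices W i j k"
proof -
  have "is_triangle E8star (i, j) (j, k) (k, i)"
    using assms(2-4) by (simp add: is_triangle_def E8star_def)
  then show ?thesis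
    using assms(1) unfolding rotation_invariant_def on_vertices_def by metis
qed

text \<open>Up to the gauge freedom these relations determine the system. The absolute values of the
  triangles through a loop solve a quadratic equation; the wrong root is excluded by type I at
  the edge \<open>2 \<rightarrow> 3\<close>, which ties the two loops together. In the last relation the complex
  conjugates of type II have been cleared with the help of \<open>\<bar>W\<^sub>2\<^sub>2\<^sub>3\<bar> = \<bar>W\<^sub>2\<^sub>3\<^sub>3\<bar>\<close>.\<close>

lemma cell_system_E8star_relations:
  fixes W
  defines "V \<equiv> on_vertices W"
  assumes "cell_system E8star phi_E8star W"
  shows "(cmod (V 1 2 3))\<^sup>2 = qint 2 * qint 3"
    and "(cmod (V 2 4 3))\<^sup>2 = qint 2 * qint 3"
    and "(cmod (V 2 2 3))\<^sup>2 = qint 2 * (qint 3 + 1) / 2"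
    and "(cmod (V 2 3 3))\<^sup>2 = qint 2 * (qint 3 + 1) / 2"
    and "(cmod (V 2 2 2))\<^sup>2 = qint 3 * (qint 2 * (qint 3 + 1) / 2)"
    and "(cmod (V 3 3 3))\<^sup>2 = qint 3 * (qint 2 * (qint 3 + 1) / 2)"
    and "V 2 2 2 * V 2 3 3 ^ 3 = - (V 3 3 3 * V 2 2 3 ^ 3)"
proof -
  have rot_inv: "rotation_invariant E8star W"
    and I: "type_I E8star phi_E8star W" and II: "type_II E8star phi_E8star W"
    using assms by (auto simp: cell_system_def)
  have a: "qint 3 > 0" and b: "qint 2 > 0"
    by (simp_all add: qint_pos)
  have rot: "V 3 1 2 = V 1 2 3" "V 2 3 1 = V 1 2 3"
      "V 4 3 2 = V 2 4 3" "V 3 2 4 = V 2 4 3"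
      "V 2 3 2 = V 2 2 3" "V 3 2 2 = V 2 2 3"
      "V 3 3 2 = V 2 3 3" "V 3 2 3 = V 2 3 3"
    unfolding V_def
    using on_vertices_rotate[OF rot_inv, of 1 2 3] on_vertices_rotate[OF rot_inv, of 2 3 1]
      on_vertices_rotate[OF rot_inv, of 2 4 3] on_vertices_rotate[OF rot_inv, of 4 3 2]
      on_vertices_rotate[OF rot_inv, of 2 2 3] on_vertices_rotate[OF rot_inv, of 2 3 2]
      on_vertices_rotate[OF rot_inv, of 2 3 3] on_vertices_rotate[OF rot_inv, of 3 3 2]
    by (simp_all add: mem_arcs_E8star)
  define n where "n i j k = (cmod (V i j k))\<^sup>2" for i j k
  have n: "V i j k * cnj (V i j k) = of_real (n i j k)" for i j k
    by (simp add: n_def flip: complex_norm_square)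
  have I_n: "(\<Sum>k\<in>verts E8star. of_bool ((j, k) \<in> arcs E8star \<and> (k, i) \<in> arcs E8star) * n i j k)
      = qint 2 * phi_E8star i * phi_E8star j" if "(i, j) \<in> arcs E8star" for i j
  proof -
    have "i \<in> verts E8star" "j \<in> verts E8star"
      using that by (auto simp: mem_arcs_E8star verts_E8star)
    with I that show ?thesis
      unfolding type_I_E8star_iff V_def[symmetric] n
        of_bool_eq_complex_of_real of_real_mult[symmetric] of_real_sum[symmetric] of_real_eq_iff
      by blast
  qed
  have rot_n: "n 3 2 2 = n 2 2 3" "n 3 3 2 = n 2 3 3" "n 2 3 1 = n 1 2 3" "n 2 3 2 = n 2 2 3"
    by (simp_all only: n_def rot)
  show n_12: "(cmod (V 1 2 3))\<^sup>2 = qint 2 * qint 3"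
    using I_n[of 1 2] by (simp add: mem_arcs_E8star verts_E8star phi_E8star_def flip: n_def)
  show "(cmod (V 2 4 3))\<^sup>2 = qint 2 * qint 3"
    using I_n[of 2 4] by (simp add: mem_arcs_E8star verts_E8star phi_E8star_def flip: n_def)
  have n_22: "n 2 2 2 + n 2 2 3 = qint 2 * (qint 3)\<^sup>2"
    using I_n[of 2 2]
    by (simp add: mem_arcs_E8star verts_E8star phi_E8star_def rot_n power2_eq_square mult.assoc)
  have n_33: "n 3 3 3 + n 2 3 3 = qint 2 * (qint 3)\<^sup>2"
    using I_n[of 3 3]
    by (simp add: mem_arcs_E8star verts_E8star phi_E8star_def rot_n power2_eq_square mult.assoc)
  have "n 1 2 3 + n 2 2 3 + n 2 3 3 = qint 2 * (qint 3)\<^sup>2"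
    using I_n[of 2 3]
    by (simp add: mem_arcs_E8star verts_E8star phi_E8star_def rot_n power2_eq_square mult.assoc
        del: One_nat_def)
  with n_12 have n_23: "n 2 2 3 + n 2 3 3 = qint 2 * (qint 3 + 1)"
    unfolding qint_3_squared by (simp add: n_def algebra_simps)
  have II_n: "(\<Sum>k\<in>verts E8star. of_bool ((j, k) \<in> arcs E8star \<and> (k, i) \<in> arcs E8star) *
        (inverse (phi_E8star k) * (n i j k)\<^sup>2))
      = phi_E8star i * phi_E8star j * phi_E8star i + phi_E8star i * phi_E8star j * phi_E8star j"
    if "(i, j) \<in> arcs E8star" for i j
  proof -
    have "i \<in> verts E8star" "j \<in> verts E8star"
      using that by (auto simp: mem_arcs_E8star verts_E8star)
    have summand: "complex_of_real (inverse (phi_E8star k)) * V i j k * cnj (V i j k) *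
        V i j k * cnj (V i j k) = of_real (inverse (phi_E8star k) * (n i j k)\<^sup>2)" for k
      unfolding of_real_mult power2_eq_square n[symmetric] by (simp only: mult.assoc)
    have dup: "P \<and> Q \<and> Q \<and> P \<longleftrightarrow> P \<and> Q" for P Q
      by blast
    show ?thesis
      using II[unfolded type_II_E8star_iff V_def[symmetric], rule_format, of i j i j]
        that \<open>i \<in> verts E8star\<close> \<open>j \<in> verts E8star\<close>
      unfolding summand dup of_bool_eq_complex_of_real
        of_real_mult[symmetric] of_real_sum[symmetric] of_real_eq_iff
      by simp
  qed
  have "(n 2 2 2)\<^sup>2 + (n 2 2 3)\<^sup>2 = 2 * qint 3 ^ 4"
    using II_n[of 2 2] a
    by (simp add: mem_arcs_E8star verts_E8star phi_E8star_def rot_n field_simps power4_eq_xxxx)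
  moreover have "(n 3 3 3)\<^sup>2 + (n 2 3 3)\<^sup>2 = 2 * qint 3 ^ 4"
    using II_n[of 3 3] a
    by (simp add: mem_arcs_E8star verts_E8star phi_E8star_def rot_n field_simps power4_eq_xxxx)
  \<comment> \<open>The numbers \<open>n 2 2 3\<close> and \<open>n 2 3 3\<close> are roots of the same monic quadratic with linear
    coefficient \<open>- [2] [3]\<^sup>2\<close>; the second factor vanishes when they are its two different roots.\<close>
  ultimately have "(n 2 2 3 - n 2 3 3) * (n 2 2 3 + n 2 3 3 - qint 2 * (qint 3)\<^sup>2) = 0"
    using n_22 n_33 by algebra
  moreover have "n 2 2 3 + n 2 3 3 - qint 2 * (qint 3)\<^sup>2 \<noteq> 0"
    unfolding n_23 qint_3_squared using a b by (simp add: algebra_simps)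
  ultimately have eq: "n 2 2 3 = n 2 3 3"
    by simp
  show n223: "(cmod (V 2 2 3))\<^sup>2 = qint 2 * (qint 3 + 1) / 2"
    using n_23 eq by (simp add: n_def)
  show n233: "(cmod (V 2 3 3))\<^sup>2 = qint 2 * (qint 3 + 1) / 2"
    using n_23 eq by (simp add: n_def)
  show "(cmod (V 2 2 2))\<^sup>2 = qint 3 * (qint 2 * (qint 3 + 1) / 2)"
    using n223 n_22 qint_3_squared unfolding n_def by algebra
  show "(cmod (V 3 3 3))\<^sup>2 = qint 3 * (qint 2 * (qint 3 + 1) / 2)"
    using n233 n_33 qint_3_squared unfolding n_def by algebra
  define m where "m = complex_of_real (n 2 2 3)"
  have m: "V 2 2 3 * cnj (V 2 2 3) = m" "V 2 3 3 * cnj (V 2 3 3) = m"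
    by (simp_all add: n m_def eq)
  have "n 2 2 3 > 0"
    unfolding n_def n223 using a b by simp
  then have "m \<noteq> 0"
    by (simp add: m_def)
  have "V 2 2 2 * V 2 3 3 * (cnj (V 2 2 3))\<^sup>2 + V 2 2 3 * V 3 3 3 * (cnj (V 2 3 3))\<^sup>2 = 0"
    using II[unfolded type_II_E8star_iff V_def[symmetric], rule_format, of 2 2 3 3] a
    by (simp add: mem_arcs_E8star verts_E8star phi_E8star_def rot power2_eq_square field_simps)
  \<comment> \<open>Multiply by \<open>(V 2 2 3)\<^sup>2 (V 2 3 3)\<^sup>2\<close>.\<close>
  then have "m\<^sup>2 * (V 2 2 2 * V 2 3 3 ^ 3 + V 3 3 3 * V 2 2 3 ^ 3) = 0"
    using m by algebra
  then show "V 2 2 2 * V 2 3 3 ^ 3 = - (V 3 3 3 * V 2 2 3 ^ 3)"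
    using \<open>m \<noteq> 0\<close> by (simp add: eq_neg_iff_add_eq_0)
qed

text \<open>A unitary matrix indexed by a single edge is a phase, and each sum in the definition of
  equivalence has one term.\<close>

lemma cell_equiv_E8starI:
  fixes g :: "nat \<times> nat \<Rightarrow> complex"
  assumes "\<And>e. cmod (g e) = 1"
    and "\<And>i j k. (i, j) \<in> arcs E8star \<Longrightarrow> (j, k) \<in> arcs E8star \<Longrightarrow> (k, i) \<in> arcs E8star \<Longrightarrow>
      on_vertices W\<^sub>1 i j k = g (i, j) * g (j, k) * g (k, i) * on_vertices W\<^sub>2 i j k"
  shows "cell_equiv E8star W\<^sub>1 W\<^sub>2"
proof -
  have "g e * cnj (g e) = 1" for e
    using assms(1)[of e] by (simp flip: complex_norm_square)
  then have "unitary_on (arcs_from_to E8star i j) (\<lambda>e f. g e)" for i j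
    by (simp add: unitary_on_def arcs_from_to_E8star mult.commute)
  with assms(2) show ?thesis
    unfolding cell_equiv_def ball_arcs_from_to_E8star sum_arcs_from_to_E8star on_vertices_def
    by (intro exI[of _ "\<lambda>e f. g e"]) auto
qed

text \<open>The ratios \<open>p\<close> of corresponding cells are phases, and the last relation of
  \<open>cell_system_E8star_relations\<close> leaves \<open>p\<^sub>2\<^sub>2\<^sub>2 p\<^sub>2\<^sub>3\<^sub>3\<^sup>3 = p\<^sub>3\<^sub>3\<^sub>3 p\<^sub>2\<^sub>2\<^sub>3\<^sup>3\<close>. The threefold loop at \<open>2\<close>
  forces its edge phase to be a cube root \<open>c\<close> of \<open>p\<^sub>2\<^sub>2\<^sub>2\<close>; with the phases of \<open>1 \<rightarrow> 2\<close>, \<open>3 \<rightarrow> 2\<close> and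
  \<open>4 \<rightarrow> 3\<close> normalised to \<open>1\<close>, the remaining ones are read off one triangle after the other, and
  the relation is what makes the threefold loop at \<open>3\<close> come out right.\<close>

lemma cell_system_E8star_unique:
  assumes "cell_system E8star phi_E8star W\<^sub>1" "cell_system E8star phi_E8star W\<^sub>2"
  shows "cell_equiv E8star W\<^sub>1 W\<^sub>2"
proof -
  define V\<^sub>1 where "V\<^sub>1 = on_vertices W\<^sub>1"
  define V\<^sub>2 where "V\<^sub>2 = on_vertices W\<^sub>2"
  note V1 = cell_system_E8star_relations[OF assms(1), folded V\<^sub>1_def]
  note V2 = cell_system_E8star_relations[OF assms(2), folded V\<^sub>2_def]
  have rot: "rotation_invariant E8star W\<^sub>1" "rotation_invariant E8star W\<^sub>2"
    using assms by (auto simp: cell_system_def)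
  have a: "qint 3 > 0" and b: "qint 2 > 0"
    by (simp_all add: qint_pos)
  define p where "p i j k = V\<^sub>1 i j k / V\<^sub>2 i j k" for i j k
  have unit: "cmod x = cmod y \<and> y \<noteq> 0" if "(cmod x)\<^sup>2 = r" "(cmod y)\<^sup>2 = r" "r > 0" for x y r
    using that by (metis norm_ge_zero norm_zero order_less_irrefl power2_eq_imp_eq zero_power2)
  have nz: "V\<^sub>2 1 2 3 \<noteq> 0" "V\<^sub>2 2 4 3 \<noteq> 0" "V\<^sub>2 2 2 3 \<noteq> 0"
      "V\<^sub>2 2 3 3 \<noteq> 0" "V\<^sub>2 2 2 2 \<noteq> 0" "V\<^sub>2 3 3 3 \<noteq> 0"
    and norm_p: "cmod (p 1 2 3) = 1" "cmod (p 2 4 3) = 1" "cmod (p 2 2 3) = 1" "cmod (p 2 3 3) = 1"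
      "cmod (p 2 2 2) = 1" "cmod (p 3 3 3) = 1"
    using a b unit[OF V1(1) V2(1)] unit[OF V1(2) V2(2)] unit[OF V1(3) V2(3)]
      unit[OF V1(4) V2(4)] unit[OF V1(5) V2(5)] unit[OF V1(6) V2(6)]
    by (auto simp: p_def norm_divide)
  have V1_eq: "V\<^sub>1 1 2 3 = p 1 2 3 * V\<^sub>2 1 2 3" "V\<^sub>1 2 4 3 = p 2 4 3 * V\<^sub>2 2 4 3"
      "V\<^sub>1 2 2 3 = p 2 2 3 * V\<^sub>2 2 2 3" "V\<^sub>1 2 3 3 = p 2 3 3 * V\<^sub>2 2 3 3"
      "V\<^sub>1 2 2 2 = p 2 2 2 * V\<^sub>2 2 2 2" "V\<^sub>1 3 3 3 = p 3 3 3 * V\<^sub>2 3 3 3"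
    using nz by (simp_all add: p_def)
  have "(p 2 2 2 * p 2 3 3 ^ 3 - p 3 3 3 * p 2 2 3 ^ 3) * (V\<^sub>2 3 3 3 * V\<^sub>2 2 2 3 ^ 3) = 0"
    using V1(7) V2(7) unfolding V1_eq by algebra
  then have phase: "p 2 2 2 * p 2 3 3 ^ 3 = p 3 3 3 * p 2 2 3 ^ 3"
    using nz by simp
  have p_nz: "p 2 2 3 \<noteq> 0"
    using norm_p by auto
  obtain c where c: "c ^ 3 = p 2 2 2" "cmod c = 1"
  proof
    define \<theta> where "\<theta> = Arg (p 2 2 2)"
    have "p 2 2 2 = cis \<theta>"
      using norm_p(5) cis_Arg[of "p 2 2 2"] by (cases "p 2 2 2 = 0") (simp_all add: \<theta>_def sgn_eq)
    then show "cis (\<theta> / 3) ^ 3 = p 2 2 2"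
      using Complex.DeMoivre[of "\<theta> / 3" 3] by simp
    show "cmod (cis (\<theta> / 3)) = 1"
      by simp
  qed
  then have c_nz: "c \<noteq> 0"
    by auto
  define g :: "nat \<times> nat \<Rightarrow> complex" where
    "g e = (if e = (2, 2) then c
            else if e = (2, 3) then p 2 2 3 / c
            else if e = (3, 1) then p 1 2 3 * c / p 2 2 3
            else if e = (3, 3) then p 2 3 3 * c / p 2 2 3
            else if e = (2, 4) then p 2 4 3
            else 1)" for e
  have g: "g (2, 2) = c" "g (2, 3) = p 2 2 3 / c" "g (3, 1) = p 1 2 3 * c / p 2 2 3"
      "g (3, 3) = p 2 3 3 * c / p 2 2 3" "g (2, 4) = p 2 4 3"
      "g (1, 2) = 1" "g (3, 2) = 1" "g (4, 3) = 1"
    by (simp_all add: g_def)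
  show ?thesis
  proof (rule cell_equiv_E8starI)
    show "cmod (g e) = 1" for e
      using norm_p c by (simp add: g_def norm_mult norm_divide)
    define ok where "ok i j k \<longleftrightarrow> V\<^sub>1 i j k = g (i, j) * g (j, k) * g (k, i) * V\<^sub>2 i j k" for i j k
    have ok_rotate: "ok j k i"
      if "ok i j k" "(i, j) \<in> arcs E8star" "(j, k) \<in> arcs E8star" "(k, i) \<in> arcs E8star" for i j k
      using that(1) on_vertices_rotate[OF rot(1) that(2-4)] on_vertices_rotate[OF rot(2) that(2-4)]
      by (simp add: ok_def V\<^sub>1_def V\<^sub>2_def mult_ac)
    have base: "ok 1 2 3" "ok 2 4 3" "ok 2 2 3" "ok 2 3 3" "ok 2 2 2"
      unfolding ok_def V1_eq g c(1)[symmetric] power3_eq_cube using p_nz c_nz by simp_all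
    have "g (3, 3) ^ 3 = p 3 3 3"
      using phase p_nz by (simp add: g power_divide power_mult_distrib c(1) mult.commute)
    then have base_333: "ok 3 3 3"
      by (simp add: ok_def V1_eq power3_eq_cube)
    have rotated: "ok 2 3 1" "ok 4 3 2" "ok 2 3 2" "ok 3 3 2"
      using base(1-4)[THEN ok_rotate] by (simp_all add: mem_arcs_E8star)
    have rotated_twice: "ok 3 1 2" "ok 3 2 4" "ok 3 2 2" "ok 3 2 3"
      using rotated[THEN ok_rotate] by (simp_all add: mem_arcs_E8star)
    have all_ok: "\<forall>i\<in>verts E8star. \<forall>j\<in>verts E8star. \<forall>k\<in>verts E8star.
        (i, j) \<in> arcs E8star \<longrightarrow> (j, k) \<in> arcs E8star \<longrightarrow> (k, i) \<in> arcs E8star \<longrightarrow> ok i j k"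
      using base base_333 rotated rotated_twice by (simp add: verts_E8star mem_arcs_E8star)
    fix i j k
    assume *: "(i, j) \<in> arcs E8star" "(j, k) \<in> arcs E8star" "(k, i) \<in> arcs E8star"
    then have "i \<in> verts E8star" "j \<in> verts E8star" "k \<in> verts E8star"
      by (auto simp: mem_arcs_E8star verts_E8star)
    with all_ok * have "ok i j k"
      by blast
    then show "on_vertices W\<^sub>1 i j k = g (i, j) * g (j, k) * g (k, i) * on_vertices W\<^sub>2 i j k"
      by (simp add: ok_def V\<^sub>1_def V\<^sub>2_def)
  qed
qed

theorem theorem10p1:
  shows "(\<exists>W. cell_system E8star phi_E8star W \<and>
            on_vertices W 1 2 3 = of_real (sqrt (qint 2 * qint 3)) \<and>
            on_vertices W 2 4 3 = of_real (sqrt (qint 2 * qint 3)) \<and>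
            on_vertices W 2 2 3 = of_real (qint 3 / sqrt (qint 2)) \<and>
            on_vertices W 2 3 3 = of_real (qint 3 / sqrt (qint 2)) \<and>
            on_vertices W 2 2 2 = of_real (sqrt (qint 3 ^ 3) / sqrt (qint 2)) \<and>
            on_vertices W 3 3 3 = of_real (- (sqrt (qint 3 ^ 3) / sqrt (qint 2)))) \<and>
         (\<forall>W\<^sub>1 W\<^sub>2. cell_system E8star phi_E8star W\<^sub>1 \<and> cell_system E8star phi_E8star W\<^sub>2
            \<longrightarrow> cell_equiv E8star W\<^sub>1 W\<^sub>2)"
proof (intro conjI)
  let ?W = "E8star_cell (sqrt (qint 2 * qint 3)) (qint 3 / sqrt (qint 2))
              (sqrt (qint 3 ^ 3) / sqrt (qint 2))"
  have "cell_system E8star phi_E8star ?W"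
    unfolding cell_system_def
    by (intro conjI fin_digraph_E8star perron_frobenius_E8star rotation_invariant_E8star_cell
        type_I_E8star_cell type_II_E8star_cell E8star_weight_relations)
  moreover have "on_vertices ?W 1 2 3 = of_real (sqrt (qint 2 * qint 3))"
      "on_vertices ?W 2 4 3 = of_real (sqrt (qint 2 * qint 3))"
      "on_vertices ?W 2 2 3 = of_real (qint 3 / sqrt (qint 2))"
      "on_vertices ?W 2 3 3 = of_real (qint 3 / sqrt (qint 2))"
      "on_vertices ?W 2 2 2 = of_real (sqrt (qint 3 ^ 3) / sqrt (qint 2))"
      "on_vertices ?W 3 3 3 = of_real (- (sqrt (qint 3 ^ 3) / sqrt (qint 2)))"
    unfolding on_vertices_E8star_cell by (simp_all add: E8star_weight_def)
  ultimately show "\<exists>W. cell_system E8star phi_E8star W \<and>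
            on_vertices W 1 2 3 = of_real (sqrt (qint 2 * qint 3)) \<and>
            on_vertices W 2 4 3 = of_real (sqrt (qint 2 * qint 3)) \<and>
            on_vertices W 2 2 3 = of_real (qint 3 / sqrt (qint 2)) \<and>
            on_vertices W 2 3 3 = of_real (qint 3 / sqrt (qint 2)) \<and>
            on_vertices W 2 2 2 = of_real (sqrt (qint 3 ^ 3) / sqrt (qint 2)) \<and>
            on_vertices W 3 3 3 = of_real (- (sqrt (qint 3 ^ 3) / sqrt (qint 2)))"
    by blast
qed (use cell_system_E8star_unique in blast)

end
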